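(* Let $(M,d)$ be a proper metric space, let $(\mu_n)_{n\in\mathbf{N}}$ be a sequence in $P_1(M)$ and let $\mu\in P_1(M)$. If $(f_{\mu_n})_n$ converges uniformly on $M$ to $f_\mu$, then for every $\varepsilon>0$ there exists $N\in\mathbf{N}$ such that for every $n\ge N$, $$Q_{\mu_n}\subset B(Q_\mu,\varepsilon):=\{x\in M:d(x,Q_\mu)<\varepsilon\}.$$
   Context: A metric space is proper if every bounded closed subset is compact. $P_1(M)$ is the set of probability measures $\mu$ on $M$ with $\int_M d(x_0,p)\,\mu(dp)<\infty$ for some $x_0\in M$. For $\mu\in P_1(M)$, $f_\mu(x)=\int_M d(x,p)\,\mu(dp)$, $x\in M$; it attains its minimum, and $Q_\mu$ is the set of its global minimum points (the Fréchet medians of $\mu$). *)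

theory Defs
  imports "HOL-Probability.Probability"
begin

text \<open>
  The metric space is the whole type; an empty metric space carries no probability measure,
  so nothing is lost by types being nonempty. Measures are Borel measures.
\<close>

definition P1 :: "'a::metric_space measure set" where
  "P1 = {\<mu>. prob_space \<mu> \<and> sets \<mu> = sets borel \<and> (\<exists>x\<^sub>0. integrable \<mu> (\<lambda>p. dist x\<^sub>0 p))}"

definition mean_dist :: "'a::metric_space measure \<Rightarrow> 'a \<Rightarrow> real" where
  "mean_dist \<mu> x = (\<integral>p. dist x p \<partial>\<mu>)"

definition frechet_medians :: "'a::metric_space measure \<Rightarrow> 'a set" where
  "frechet_medians \<mu> = {x. \<forall>y. mean_dist \<mu> x \<le> mean_dist \<mu> y}"

text \<open>
  The library sets \<open>infdist x {} = 0\<close>. The guard \<open>A \<noteq> {}\<close> restores the usual reading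
  \<open>d(x, {}) = \<infinity>\<close>, so that the neighbourhood of the empty set is empty instead of everything.
\<close>

definition nbhd :: "'a::metric_space set \<Rightarrow> real \<Rightarrow> 'a set" where
  "nbhd A \<epsilon> = {x. A \<noteq> {} \<and> infdist x A < \<epsilon>}"

end

theory Submission
  imports Defs
begin

text \<open>
  The function \<open>f = mean_dist \<mu>\<close> is 1-Lipschitz, and integrating the triangle inequality gives
  \<open>dist x y \<le> f x + f y\<close>, so \<open>f\<close> tends to infinity at infinity. In a proper space its
  sublevel sets are therefore compact (\<open>compact_sublevel_mean_dist\<close>). Consequently \<open>f\<close> attains its
  minimum \<open>m\<close>, and outside any open neighbourhood of the set of minimum points \<open>f\<close> is
  at least \<open>m + \<delta>\<close> for some \<open>\<delta> > 0\<close> (\<open>minimizers_gap\<close>). As soon as \<open>mean_dist (\<mu>s n)\<close> is uniformly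
  within \<open>\<delta> / 2\<close> of \<open>f\<close>, each of its minimum points has an \<open>f\<close>-value below
  \<open>m + \<delta>\<close>, and thus lies in the neighbourhood.
\<close>

lemma P1_imp_prob_space: "\<mu> \<in> P1 \<Longrightarrow> prob_space \<mu>"
  by (simp add: P1_def)

lemma integrable_dist:
  fixes x :: "'a::metric_space"
  assumes "\<mu> \<in> P1"
  shows "integrable \<mu> (dist x)"
proof -
  interpret prob_space \<mu> using assms by (rule P1_imp_prob_space)
  from assms obtain x\<^sub>0 :: 'a where x0: "integrable \<mu> (\<lambda>p. dist x\<^sub>0 p)"
    and sets: "sets \<mu> = sets borel"
    by (auto simp: P1_def)
  have "integrable \<mu> (\<lambda>p. dist x x\<^sub>0 + dist x\<^sub>0 p)"
    using x0 by simp
  then show ?thesis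
  proof (rule Bochner_Integration.integrable_bound)
    have "dist x \<in> borel_measurable borel"
      by (intro borel_measurable_continuous_onI continuous_intros)
    then show "dist x \<in> borel_measurable \<mu>"
      using measurable_cong_sets[OF sets refl] by blast
    show "AE p in \<mu>. norm (dist x p) \<le> norm (dist x x\<^sub>0 + dist x\<^sub>0 p)"
      using dist_triangle by (intro always_eventually allI) simp
  qed
qed

lemma mean_dist_lipschitz:
  fixes x y :: "'a::metric_space"
  assumes "\<mu> \<in> P1"
  shows "mean_dist \<mu> x \<le> mean_dist \<mu> y + dist x y"
proof -
  interpret prob_space \<mu> using assms by (rule P1_imp_prob_space)
  have "mean_dist \<mu> x \<le> (\<integral>p. dist y p + dist x y \<partial>\<mu>)"
    unfolding mean_dist_def
    using integrable_dist[OF assms] dist_triangle[of x _ y]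
    by (intro integral_mono) (auto simp: add.commute)
  also have "\<dots> = mean_dist \<mu> y + dist x y"
    using integrable_dist[OF assms] by (simp add: mean_dist_def prob_space)
  finally show ?thesis .
qed

lemma continuous_on_mean_dist:
  fixes \<mu> :: "'a::metric_space measure"
  assumes "\<mu> \<in> P1"
  shows "continuous_on S (mean_dist \<mu>)"
proof -
  have "\<bar>mean_dist \<mu> x - mean_dist \<mu> y\<bar> \<le> dist x y" for x y
    using mean_dist_lipschitz[OF assms, of x y] mean_dist_lipschitz[OF assms, of y x]
    by (simp add: dist_commute abs_le_iff)
  then show ?thesis
    unfolding continuous_on_iff dist_real_def by (meson order.strict_trans1)
qed

text \<open>The triangle inequality through the point \<open>p\<close>, integrated over \<open>p\<close>.\<close>

lemma dist_le_mean_dist: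
  fixes x y :: "'a::metric_space"
  assumes "\<mu> \<in> P1"
  shows "dist x y \<le> mean_dist \<mu> x + mean_dist \<mu> y"
proof -
  interpret prob_space \<mu> using assms by (rule P1_imp_prob_space)
  have "(\<integral>p. dist x y \<partial>\<mu>) \<le> (\<integral>p. dist x p + dist y p \<partial>\<mu>)"
    using integrable_dist[OF assms] dist_triangle2[of x y]
    by (intro integral_mono) auto
  then show ?thesis
    using integrable_dist[OF assms] by (simp add: mean_dist_def prob_space)
qed

lemma compact_sublevel_mean_dist:
  fixes \<mu> :: "'a::metric_space measure"
  assumes proper: "\<And>S :: 'a set. bounded S \<Longrightarrow> closed S \<Longrightarrow> compact S"
    and "\<mu> \<in> P1"
  shows "compact {x. mean_dist \<mu> x \<le> c}"
proof (rule proper)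
  fix y :: 'a
  have "dist y x \<le> mean_dist \<mu> y + c" if "mean_dist \<mu> x \<le> c" for x
    using dist_le_mean_dist[OF assms(2), of y x] that by simp
  then show "bounded {x. mean_dist \<mu> x \<le> c}"
    unfolding bounded_def by blast
  show "closed {x. mean_dist \<mu> x \<le> c}"
    by (intro closed_Collect_le continuous_on_mean_dist assms(2) continuous_on_const)
qed

lemma compact_sublevels_attain_min:
  fixes f :: "'a::topological_space \<Rightarrow> real"
  assumes "continuous_on UNIV f" and "\<And>c. compact {x. f x \<le> c}"
  obtains q where "\<And>y. f q \<le> f y"
proof -
  fix a :: 'a
  obtain q where "f q \<le> f a" "\<And>y. f y \<le> f a \<Longrightarrow> f q \<le> f y"
    using continuous_attains_inf[OF assms(2)[of "f a"] _ continuous_on_subset[OF assms(1)]]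
    by blast
  then have "f q \<le> f y" for y
    by (meson linear order_trans)
  then show ?thesis by (rule that)
qed

text \<open>
  The points outside \<open>U\<close> whose value is at most \<open>m + 1\<close> form a compact set, on which \<open>f\<close> attains a
  minimum; it exceeds \<open>m\<close> because all minimum points of \<open>f\<close> lie in \<open>U\<close>.
\<close>

lemma minimizers_gap:
  fixes f :: "'a::topological_space \<Rightarrow> real"
  assumes cont: "continuous_on UNIV f"
    and cpt: "\<And>c. compact {x. f x \<le> c}"
    and "open U" and minimizers: "{x. \<forall>y. f x \<le> f y} \<subseteq> U"
    and min: "\<And>y. m \<le> f y"
    and attained: "f q = m"
  obtains \<delta> where "\<delta> > 0" and "\<And>x. f x < m + \<delta> \<Longrightarrow> x \<in> U"
proof (cases "{x. f x \<le> m + 1} - U = {}")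
  case True
  then show ?thesis by (intro that[of 1]) force+
next
  case False
  have "compact ({x. f x \<le> m + 1} - U)"
    using cpt \<open>open U\<close> by (rule compact_diff)
  then obtain z where z: "z \<notin> U" "\<And>x. f x \<le> m + 1 \<Longrightarrow> x \<notin> U \<Longrightarrow> f z \<le> f x"
    using continuous_attains_inf[OF _ False continuous_on_subset[OF cont]] by blast
  have "f z \<noteq> m"
    using z(1) minimizers min by auto
  then have "m < f z"
    using min[of z] by simp
  then show ?thesis
    using z(2) by (intro that[of "min 1 (f z - m)"]) force+
qed

lemma open_nbhd: "open (nbhd A \<epsilon>)"
  unfolding nbhd_def
  by (cases "A = {}") (auto intro!: open_Collect_less continuous_intros)

theorem theorem5:
  fixes \<mu> :: "'a::metric_space measure" and \<mu>s :: "nat \<Rightarrow> 'a measure"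
  assumes proper: "\<And>S :: 'a set. bounded S \<Longrightarrow> closed S \<Longrightarrow> compact S"
    and "\<And>n. \<mu>s n \<in> P1"
    and "\<mu> \<in> P1"
    and "uniform_limit UNIV (\<lambda>n. mean_dist (\<mu>s n)) (mean_dist \<mu>) sequentially"
  shows "\<forall>\<epsilon>>0. \<exists>N. \<forall>n\<ge>N. frechet_medians (\<mu>s n) \<subseteq> nbhd (frechet_medians \<mu>) \<epsilon>"
proof (intro allI impI)
  fix \<epsilon> :: real
  assume "\<epsilon> > 0"
  let ?f = "mean_dist \<mu>" and ?U = "nbhd (frechet_medians \<mu>) \<epsilon>"
  have cont: "continuous_on UNIV ?f"
    using assms(3) by (rule continuous_on_mean_dist)
  have cpt: "compact {x. ?f x \<le> c}" for c
    using proper assms(3) by (rule compact_sublevel_mean_dist)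
  obtain q where q: "\<And>y. ?f q \<le> ?f y"
    using compact_sublevels_attain_min[OF cont cpt] by blast
  have "{x. \<forall>y. ?f x \<le> ?f y} \<subseteq> ?U"
    using \<open>\<epsilon> > 0\<close> unfolding frechet_medians_def nbhd_def by auto
  then obtain \<delta> where "\<delta> > 0" and gap: "\<And>x. ?f x < ?f q + \<delta> \<Longrightarrow> x \<in> ?U"
    using minimizers_gap[OF cont cpt open_nbhd _ q refl] by blast
  have "\<forall>\<^sub>F n in sequentially. \<forall>x. dist (mean_dist (\<mu>s n) x) (?f x) < \<delta> / 2"
    using uniform_limitD[OF assms(4), of "\<delta> / 2"] \<open>\<delta> > 0\<close> by simp
  then obtain N where N: "\<And>n x. n \<ge> N \<Longrightarrow> \<bar>mean_dist (\<mu>s n) x - ?f x\<bar> < \<delta> / 2"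
    unfolding eventually_sequentially dist_real_def by blast
  have "x \<in> ?U" if "n \<ge> N" and x: "x \<in> frechet_medians (\<mu>s n)" for n x
  proof (rule gap)
    have "mean_dist (\<mu>s n) x \<le> mean_dist (\<mu>s n) q"
      using x by (simp add: frechet_medians_def)
    then show "?f x < ?f q + \<delta>"
      using N[OF \<open>n \<ge> N\<close>, of x] N[OF \<open>n \<ge> N\<close>, of q] by linarith
  qed
  then show "\<exists>N. \<forall>n\<ge>N. frechet_medians (\<mu>s n) \<subseteq> ?U"
    by blast
qed

end
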